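(* Let $(X_1,d_1)$ be a path metric space with $d_1$ unbounded, and let $(X_2,d_2)$ be a metric space with $d_2$ unbounded. Let $d=\max\{d_1,d_2\}$, i.e. $d((x_1,x_2),(y_1,y_2))=\max\{d_1(x_1,y_1),d_2(x_2,y_2)\}$ on $X_1\times X_2$. Then $(X_1\times X_2,d)$ is not Gromov hyperbolic.
   Context: For a metric space $(D,d)$ and $x,y,z\in D$, the Gromov product is $(x,y)_z=d(x,z)+d(z,y)-d(x,y)$. Put $S_d(p,q,x,w)=\min\{(p,x)_w,(x,q)_w\}-(p,q)_w$. The space $(D,d)$ is Gromov hyperbolic if $\sup_{p,q,x,w\in D}S_d(p,q,x,w)<\infty$. A metric space $(D,d)$ is a path metric space if for any $x,y\in D$ and any $\varepsilon>0$ there exists a rectifiable path joining $x$ and $y$ with length at most $d(x,y)+\varepsilon$. A metric $d$ on $X$ is unbounded if $\sup_{x,y\in X}d(x,y)=\infty$. *)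

theory Defs
  imports "HOL-Analysis.Analysis"
begin

context Metric_space
begin

text \<open>The Gromov product is taken without the customary factor \<open>1/2\<close>.\<close>

definition gromov_product :: "'a \<Rightarrow> 'a \<Rightarrow> 'a \<Rightarrow> real" where
  "gromov_product x y z = d x z + d z y - d x y"

definition gromov_defect :: "'a \<Rightarrow> 'a \<Rightarrow> 'a \<Rightarrow> 'a \<Rightarrow> real" where
  "gromov_defect p q x w =
     min (gromov_product p x w) (gromov_product x q w) - gromov_product p q w"

text \<open>
  Suprema that may be infinite are taken in \<^typ>\<open>ereal\<close>; the conditionally complete
  \<open>Sup\<close> on \<^typ>\<open>real\<close> is unspecified on unbounded sets.
\<close>

definition gromov_hyperbolic :: bool where
  "gromov_hyperbolic \<longleftrightarrow>
     (SUP (p, q, x, w) \<in> M \<times> M \<times> M \<times> M. ereal (gromov_defect p q x w)) < \<infinity>"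

definition unbounded_metric :: bool where
  "unbounded_metric \<longleftrightarrow> (SUP (x, y) \<in> M \<times> M. ereal (d x y)) = \<infinity>"

text \<open>
  A partition \<open>0 = t 0 \<le> \<dots> \<le> t n = 1\<close> of the unit interval is encoded as a pair \<open>(n, t)\<close>;
  the values of \<open>t\<close> beyond \<open>n\<close> are irrelevant.
\<close>

definition path_length :: "(real \<Rightarrow> 'a) \<Rightarrow> ereal" where
  "path_length g =
     (SUP (n, t) \<in> {(n :: nat, t :: nat \<Rightarrow> real).
                      t 0 = 0 \<and> t n = 1 \<and> (\<forall>i<n. t i \<le> t (Suc i))}.
        ereal (\<Sum>i<n. d (g (t i)) (g (t (Suc i)))))"

definition rectifiable_path :: "(real \<Rightarrow> 'a) \<Rightarrow> bool" where
  "rectifiable_path g \<longleftrightarrow> pathin mtopology g \<and> path_length g < \<infinity>"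

definition path_metric :: bool where
  "path_metric \<longleftrightarrow>
     (\<forall>x\<in>M. \<forall>y\<in>M. \<forall>\<epsilon>>0. \<exists>g.
        rectifiable_path g \<and> g 0 = x \<and> g 1 = y \<and> path_length g \<le> ereal (d x y + \<epsilon>))"

end

definition max_dist ::
    "('a \<Rightarrow> 'a \<Rightarrow> real) \<Rightarrow> ('b \<Rightarrow> 'b \<Rightarrow> real) \<Rightarrow> 'a \<times> 'b \<Rightarrow> 'a \<times> 'b \<Rightarrow> real" where
  "max_dist d1 d2 = (\<lambda>(x1, x2) (y1, y2). max (d1 x1 y1) (d2 x2 y2))"

lemma Metric_space_max_dist:
  assumes "Metric_space X1 d1" and "Metric_space X2 d2"
  shows "Metric_space (X1 \<times> X2) (max_dist d1 d2)"
proof -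
  interpret M1: Metric_space X1 d1 by fact
  interpret M2: Metric_space X2 d2 by fact
  show ?thesis
  proof
    fix x y :: "'a \<times> 'b"
    show "0 \<le> max_dist d1 d2 x y"
      by (auto simp: max_dist_def case_prod_unfold le_max_iff_disj)
    show "max_dist d1 d2 x y = max_dist d1 d2 y x"
      by (simp add: max_dist_def case_prod_unfold M1.commute M2.commute)
  next
    fix x y assume "x \<in> X1 \<times> X2" "y \<in> X1 \<times> X2"
    then obtain x1 x2 y1 y2 where *: "x = (x1, x2)" "y = (y1, y2)"
      "x1 \<in> X1" "x2 \<in> X2" "y1 \<in> X1" "y2 \<in> X2" by auto
    have "max (d1 x1 y1) (d2 x2 y2) = 0 \<longleftrightarrow> d1 x1 y1 = 0 \<and> d2 x2 y2 = 0"
      using M1.nonneg[of x1 y1] M2.nonneg[of x2 y2] by linarith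
    with * show "max_dist d1 d2 x y = 0 \<longleftrightarrow> x = y"
      by (simp add: max_dist_def)
  next
    fix x y z assume "x \<in> X1 \<times> X2" "y \<in> X1 \<times> X2" "z \<in> X1 \<times> X2"
    then obtain x1 x2 y1 y2 z1 z2 where *: "x = (x1, x2)" "y = (y1, y2)" "z = (z1, z2)"
      "x1 \<in> X1" "x2 \<in> X2" "y1 \<in> X1" "y2 \<in> X2" "z1 \<in> X1" "z2 \<in> X2" by auto
    then have "d1 x1 z1 \<le> d1 x1 y1 + d1 y1 z1" "d2 x2 z2 \<le> d2 x2 y2 + d2 y2 z2"
      by (auto intro: M1.triangle M2.triangle)
    with * show "max_dist d1 d2 x z \<le> max_dist d1 d2 x y + max_dist d1 d2 y z"
      by (auto simp: max_dist_def)
  qed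
qed

end

theory Submission
  imports Defs
begin

text \<open>
  Written out symmetrically (\<open>gromov_defect_four_point\<close>), the defect compares the two diagonals of
  a quadrilateral with its sides:
  \<open>S p q x w = d x w + d p q - max (d p x + d w q) (d x q + d p w)\<close>,
  so a space fails to be hyperbolic as soon as it contains large quadrilaterals whose diagonals
  are together much longer than either pair of opposite sides.  In the max metric such a
  quadrilateral needs a midpoint in one factor only.  Let \<open>d\<^sub>2 a b = L\<close>, and let \<open>m\<close> be an almost
  midpoint in \<open>X\<^sub>1\<close> of two points \<open>u\<close>, \<open>v\<close> at distance \<open>2 L\<close>.  The diagonal from \<open>(u, a)\<close> to
  \<open>(v, a)\<close> has length \<open>2 L\<close>, the diagonal from \<open>(m, b)\<close> to \<open>(m, a)\<close> has length \<open>L\<close>, and each of the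
  four sides has length about \<open>L\<close>; hence the defect is about \<open>3 L - 2 L = L\<close>.

  Unboundedness of \<open>d\<^sub>1\<close> gives \<open>u\<close> and a point farther than \<open>2 L\<close> from it; \<open>v\<close> and then \<open>m\<close> come
  from the intermediate value theorem: along a path, the distance to
  its starting point is continuous, so it takes every value up to the final one.  The almost
  midpoint is found in this way on an almost shortest path (\<open>path_metric_almost_between\<close>).
\<close>

lemma (in Metric_space) gromov_defect_four_point:
  "gromov_defect p q x w =
     d x w + d p q - max (d p x + d w q) (d x q + d p w)"
  unfolding gromov_defect_def gromov_product_def
  using commute[of w x] commute[of w q] by linarith

lemma (in Metric_space) gromov_hyperbolic_bounded:
  assumes "gromov_hyperbolic"
  obtains C where "\<And>p q x w. \<lbrakk>p \<in> M; q \<in> M; x \<in> M; w \<in> M\<rbrakk> \<Longrightarrow> gromov_defect p q x w \<le> C"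
proof -
  let ?S = "SUP (p, q, x, w) \<in> M \<times> M \<times> M \<times> M. ereal (gromov_defect p q x w)"
  obtain C where C: "?S \<le> ereal C"
    using assms less_PInf_Ex_of_nat[of ?S] by (auto simp: gromov_hyperbolic_def intro: less_imp_le)
  have "gromov_defect p q x w \<le> C" if "p \<in> M" "q \<in> M" "x \<in> M" "w \<in> M" for p q x w
  proof -
    have "ereal (gromov_defect p q x w) \<le> ?S"
      using that by (intro SUP_upper2[of "(p, q, x, w)"]) auto
    also note C
    finally show ?thesis by simp
  qed
  then show thesis using that by blast
qed

lemma (in Metric_space) unbounded_metric_far_points:
  assumes "unbounded_metric"
  obtains x y where "x \<in> M" "y \<in> M" "d x y > B"
proof -
  have "ereal B < (SUP (x, y) \<in> M \<times> M. ereal (d x y))"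
    using assms by (simp add: unbounded_metric_def)
  then show thesis
    using that by (auto simp: less_SUP_iff)
qed

text \<open>
  The three-point partition \<open>0 \<le> s \<le> 1\<close> already gives this bound.  It forces every point of an
  almost shortest path to lie almost between the endpoints.
\<close>

lemma (in Metric_space) path_length_ge_via_point:
  assumes "0 \<le> s" "s \<le> 1"
  shows "ereal (d (g 0) (g s) + d (g s) (g 1)) \<le> path_length g"
proof -
  define t where "t = (\<lambda>i::nat. if i = 0 then 0 else if i = 1 then s else 1)"
  have "(\<Sum>i<2. d (g (t i)) (g (t (Suc i)))) = d (g 0) (g s) + d (g s) (g 1)"
    by (simp add: t_def numeral_2_eq_2)
  moreover have "t 0 = 0" "t 2 = 1" "\<forall>i<2. t i \<le> t (Suc i)"
    using assms by (auto simp: t_def)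
  ultimately show ?thesis
    unfolding path_length_def by (intro SUP_upper2[of "(2, t)"]) auto
qed

lemma (in Metric_space) path_attains_distance:
  assumes g: "pathin mtopology g" and r: "0 \<le> r" "r \<le> d (g 0) (g 1)"
  obtains s where "0 \<le> s" "s \<le> 1" "g s \<in> M" "d (g 0) (g s) = r"
proof -
  have cont: "continuous_map (top_of_set {0..1}) mtopology g"
    using g by (simp add: pathin_def)
  then have inM: "g s \<in> M" if "0 \<le> s" "s \<le> 1" for s
    using that by (auto simp: continuous_map_def Pi_iff)
  then have "continuous_map (top_of_set {0..1}) mtopology (\<lambda>_. g 0)"
    by simp
  then have "continuous_map (top_of_set {0..1}) euclideanreal (\<lambda>s. d (g 0) (g s))"
    using continuous_map_mdist[of "top_of_set {0..1}" Self "\<lambda>_. g 0" g] cont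
    by (simp add: mtopology_of_def)
  then have "continuous_on {0..1} (\<lambda>s. d (g 0) (g s))"
    by simp
  moreover have "d (g 0) (g 0) = 0"
    using inM[of 0] by simp
  ultimately obtain s where "0 \<le> s" "s \<le> 1" "d (g 0) (g s) = r"
    using IVT'[of "\<lambda>s. d (g 0) (g s)" 0 r 1] r by auto
  with inM that show thesis by blast
qed

lemma (in Metric_space) path_metric_almost_between:
  assumes "path_metric" "x \<in> M" "y \<in> M" "0 \<le> r" "r \<le> d x y" "\<epsilon> > 0"
  obtains m where "m \<in> M" "d x m = r" "d m y \<le> d x y - r + \<epsilon>"
proof -
  obtain g where g: "rectifiable_path g" "g 0 = x" "g 1 = y"
    and len: "path_length g \<le> ereal (d x y + \<epsilon>)"
    using assms unfolding path_metric_def by blast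
  obtain s where s: "0 \<le> s" "s \<le> 1" "g s \<in> M" "d x (g s) = r"
    using path_attains_distance[of g r] g assms by (auto simp: rectifiable_path_def)
  have "ereal (d x (g s) + d (g s) y) \<le> ereal (d x y + \<epsilon>)"
    using order_trans[OF path_length_ge_via_point[OF s(1,2), of g] len] g by simp
  with s that[of "g s"] show thesis by simp
qed

theorem proposition1:
  fixes X1 :: "'a set" and d1 :: "'a \<Rightarrow> 'a \<Rightarrow> real"
    and X2 :: "'b set" and d2 :: "'b \<Rightarrow> 'b \<Rightarrow> real"
  assumes "Metric_space X1 d1"
    and "Metric_space.path_metric X1 d1"
    and "Metric_space.unbounded_metric X1 d1"
    and "Metric_space X2 d2"
    and "Metric_space.unbounded_metric X2 d2"
  shows "\<not> Metric_space.gromov_hyperbolic (X1 \<times> X2) (max_dist d1 d2)"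
proof
  assume hyp: "Metric_space.gromov_hyperbolic (X1 \<times> X2) (max_dist d1 d2)"
  interpret M1: Metric_space X1 d1 by fact
  interpret M2: Metric_space X2 d2 by fact
  interpret P: Metric_space "X1 \<times> X2" "max_dist d1 d2"
    by (rule Metric_space_max_dist) fact+
  obtain C where C: "\<And>p q x w. \<lbrakk>p \<in> X1 \<times> X2; q \<in> X1 \<times> X2; x \<in> X1 \<times> X2; w \<in> X1 \<times> X2\<rbrakk>
      \<Longrightarrow> P.gromov_defect p q x w \<le> C"
    using P.gromov_hyperbolic_bounded[OF hyp] by blast
  \<comment> \<open>The quadrilateral below has defect at least \<open>L - 1\<close>, where \<open>1\<close> is the error allowed for the
    almost midpoint.\<close>
  obtain a b where ab: "a \<in> X2" "b \<in> X2" "d2 a b > max 0 (C + 1)"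
    using M2.unbounded_metric_far_points[OF assms(5)] by blast
  define L where "L = d2 a b"
  have L: "L > 0" "L > C + 1"
    using ab by (auto simp: L_def)
  obtain u v where uv: "u \<in> X1" "v \<in> X1" "d1 u v = 2 * L"
  proof -
    obtain u v' where "u \<in> X1" "v' \<in> X1" "d1 u v' > 2 * L"
      using M1.unbounded_metric_far_points[OF assms(3)] by blast
    then obtain v where "v \<in> X1" "d1 u v = 2 * L"
      using M1.path_metric_almost_between[OF assms(2), of u v' "2 * L" 1] L by auto
    with \<open>u \<in> X1\<close> that show thesis by blast
  qed
  obtain m where m: "m \<in> X1" "d1 u m = L" "d1 m v \<le> L + 1"
    using M1.path_metric_almost_between[OF assms(2), of u v L 1] uv L by auto
  have diagonals: "max_dist d1 d2 (u, a) (v, a) = 2 * L" "max_dist d1 d2 (m, b) (m, a) = L"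
    using uv m ab L by (auto simp: max_dist_def M2.commute[of b a] L_def)
  have sides:
    "max_dist d1 d2 (m, b) (u, a) = L" "max_dist d1 d2 (v, a) (m, a) \<le> L + 1"
    "max_dist d1 d2 (u, a) (m, a) = L" "max_dist d1 d2 (m, b) (v, a) \<le> L + 1"
    using m ab L
    by (auto simp: max_dist_def M1.commute[of m u] M1.commute[of v m] M2.commute[of b a] L_def)
  have "L - 1 \<le> P.gromov_defect (m, b) (m, a) (u, a) (v, a)"
    unfolding P.gromov_defect_four_point using diagonals sides by linarith
  also have "\<dots> \<le> C"
    using ab uv m by (intro C) auto
  finally show False
    using L by simp
qed

end
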